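(* Let $1\le m_1<m_2$ be integers, $s=m_2-m_1$, $m=m_2-1$, and consider the two linear regression models $\eta_1(x,\theta_1)=\sum_{i=0}^{m_1-1}\theta_{1,i}f_i(x)$ and $\eta_2(x,\theta_2)=\sum_{i=0}^{m_2-1}\theta_{2,i}f_i(x)$ on the compact design space $\mathcal{X}$, where $f_0,\ldots,f_m$ are linearly independent continuous functions on $\mathcal{X}$. Let $\bar\pi$ be a prior distribution for the vector $b\in\mathcal{B}\subset\mathbb{R}^{s-1}$ such that the matrix $$L=\int_{\mathcal{B}}\begin{pmatrix} bb^T & b\\ b^T & 1\end{pmatrix}\bar\pi(db)\in\mathbb{R}^{s\times s}$$ exists. Then for an approximate design $\xi^*$ the following two statements are equivalent: (1) $\xi^*$ is a Bayesian $T$-optimal discriminating design with respect to the prior $\bar\pi$ for the regression models $\eta_1,\eta_2$. (2) $\xi^*$ maximizes the linear criterion $\operatorname{tr}\,LM_{(s)}(\xi)$ in the class of all approximate designs $\xi$ for which there exists a solution $X\in\mathbb{R}^{(m-s+1)\times s}$ of the equation $M_{11}(\xi)X=M_{12}(\xi)$.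
   Context: The design space $\mathcal{X}\subset\mathbb{R}^k$ is compact. An approximate design is a probability measure $\xi$ on $\mathcal{X}$ with finite support. The parameter $\theta_1$ ranges over all of $\mathbb{R}^{m_1}$; note $m_1=m-s+1$. The vector $b=(b_1,\ldots,b_{s-1})^T$ represents the ratios $b_i=\theta_{2,m-s+i}/\theta_{2,m}$, $i=1,\ldots,s-1$. For $q=(q_0,\ldots,q_{m-s})^T\in\mathbb{R}^{m-s+1}$ and $b\in\mathbb{R}^{s-1}$ put $$\bar\eta(x,q,b,1)=\sum_{i=0}^{m-s}q_if_i(x)-\bigl(b_1f_{m-s+1}(x)+\cdots+b_{s-1}f_{m-1}(x)+f_m(x)\bigr).$$ A design is called Bayesian $T$-optimal discriminating with respect to the prior $\bar\pi$ if it maximizes, among all approximate designs, $$V_B(\xi)=\int_{\mathcal{B}}\ \inf_{q\in\mathbb{R}^{m-s+1}}\int_{\mathcal{X}}\bar\eta^2(x,q,b,1)\,\xi(dx)\ \bar\pi(db).$$ Put $f_{(1)}(x)=(f_0(x),\ldots,f_{m-s}(x))^T\in\mathbb{R}^{m-s+1}$, $f_{(2)}(x)=(f_{m-s+1}(x),\ldots,f_m(x))^T\in\mathbb{R}^s$, and $$M_{ij}(\xi)=\int_{\mathcal{X}}f_{(i)}(x)f_{(j)}^T(x)\,\xi(dx),\qquad i,j=1,2.$$ The Schur complement is $M_{(s)}(\xi)=M_{22}(\xi)-X^TM_{11}(\xi)X\in\mathbb{R}^{s\times s}$, where $X\in\mathbb{R}^{(m-s+1)\times s}$ is an arbitrary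 solution of $M_{11}(\xi)X=M_{12}(\xi)$ (if there is no solution, $M_{(s)}(\xi)$ is undefined). *)

theory Defs
  imports "HOL-Probability.Probability" "Jordan_Normal_Form.Matrix"
begin

unbundle no vec_syntax

definition linearly_independent_on :: "'a set \<Rightarrow> nat \<Rightarrow> (nat \<Rightarrow> 'a \<Rightarrow> real) \<Rightarrow> bool" where
  "linearly_independent_on \<X> m f \<longleftrightarrow>
     (\<forall>c. (\<forall>x\<in>\<X>. (\<Sum>i\<le>m. c i * f i x) = 0) \<longrightarrow> (\<forall>i\<le>m. c i = 0))"

definition approximate_design :: "'a set \<Rightarrow> 'a pmf \<Rightarrow> bool" where
  "approximate_design \<X> \<xi> \<longleftrightarrow> finite (set_pmf \<xi>) \<and> set_pmf \<xi> \<subseteq> \<X>"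

text \<open>
  The space \<open>\<real>\<^sup>s\<^sup>-\<^sup>1\<close> of vectors \<open>b = (b\<^sub>1, \<dots>, b\<^sub>s\<^sub>-\<^sub>1)\<close> is the product measurable space over the
  index set \<open>{1..<s}\<close>; it is a single point if \<open>s = 1\<close>. A prior is a probability measure on a subset
  \<open>B\<close> of it, with the Borel sets of \<open>B\<close> as measurable sets.
\<close>

definition prior_on :: "nat \<Rightarrow> (nat \<Rightarrow> real) set \<Rightarrow> (nat \<Rightarrow> real) measure \<Rightarrow> bool" where
  "prior_on s B \<pi> \<longleftrightarrow>
     B \<subseteq> ({1..<s} \<rightarrow>\<^sub>E UNIV) \<and>
     sets \<pi> = sets (restrict_space (\<Pi>\<^sub>M i\<in>{1..<s}. (borel :: real measure)) B) \<and>
     prob_space \<pi>"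

definition \<eta>_bar :: "nat \<Rightarrow> nat \<Rightarrow> (nat \<Rightarrow> 'a \<Rightarrow> real) \<Rightarrow> 'a \<Rightarrow> real vec \<Rightarrow> (nat \<Rightarrow> real) \<Rightarrow> real" where
  "\<eta>_bar m s f x q b =
     (\<Sum>i=0..m-s. q $ i * f i x) - ((\<Sum>i=1..<s. b i * f (m - s + i) x) + f m x)"

definition V_B ::
  "nat \<Rightarrow> nat \<Rightarrow> (nat \<Rightarrow> 'a \<Rightarrow> real) \<Rightarrow> (nat \<Rightarrow> real) measure \<Rightarrow> 'a pmf \<Rightarrow> real" where
  "V_B m s f \<pi> \<xi> =
     (\<integral>b. (INF q \<in> carrier_vec (m - s + 1).
            measure_pmf.expectation \<xi> (\<lambda>x. (\<eta>_bar m s f x q b)\<^sup>2)) \<partial>\<pi>)"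

definition bayesian_T_optimal ::
  "'a set \<Rightarrow> nat \<Rightarrow> nat \<Rightarrow> (nat \<Rightarrow> 'a \<Rightarrow> real) \<Rightarrow> (nat \<Rightarrow> real) measure \<Rightarrow> 'a pmf \<Rightarrow> bool" where
  "bayesian_T_optimal \<X> m s f \<pi> \<xi> \<longleftrightarrow>
     approximate_design \<X> \<xi> \<and>
     (\<forall>\<zeta>. approximate_design \<X> \<zeta> \<longrightarrow> V_B m s f \<pi> \<zeta> \<le> V_B m s f \<pi> \<xi>)"

definition f\<^sub>1 :: "nat \<Rightarrow> nat \<Rightarrow> (nat \<Rightarrow> 'a \<Rightarrow> real) \<Rightarrow> 'a \<Rightarrow> real vec" where
  "f\<^sub>1 m s f x = vec (m - s + 1) (\<lambda>i. f i x)"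

definition f\<^sub>2 :: "nat \<Rightarrow> nat \<Rightarrow> (nat \<Rightarrow> 'a \<Rightarrow> real) \<Rightarrow> 'a \<Rightarrow> real vec" where
  "f\<^sub>2 m s f x = vec s (\<lambda>i. f (m - s + 1 + i) x)"

definition moment_mat ::
  "nat \<Rightarrow> nat \<Rightarrow> ('a \<Rightarrow> real vec) \<Rightarrow> ('a \<Rightarrow> real vec) \<Rightarrow> 'a pmf \<Rightarrow> real mat" where
  "moment_mat p r g h \<xi> =
     mat p r (\<lambda>(i, j). measure_pmf.expectation \<xi> (\<lambda>x. g x $ i * h x $ j))"

definition M\<^sub>1\<^sub>1 :: "nat \<Rightarrow> nat \<Rightarrow> (nat \<Rightarrow> 'a \<Rightarrow> real) \<Rightarrow> 'a pmf \<Rightarrow> real mat" where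
  "M\<^sub>1\<^sub>1 m s f \<xi> = moment_mat (m - s + 1) (m - s + 1) (f\<^sub>1 m s f) (f\<^sub>1 m s f) \<xi>"

definition M\<^sub>1\<^sub>2 :: "nat \<Rightarrow> nat \<Rightarrow> (nat \<Rightarrow> 'a \<Rightarrow> real) \<Rightarrow> 'a pmf \<Rightarrow> real mat" where
  "M\<^sub>1\<^sub>2 m s f \<xi> = moment_mat (m - s + 1) s (f\<^sub>1 m s f) (f\<^sub>2 m s f) \<xi>"

definition M\<^sub>2\<^sub>2 :: "nat \<Rightarrow> nat \<Rightarrow> (nat \<Rightarrow> 'a \<Rightarrow> real) \<Rightarrow> 'a pmf \<Rightarrow> real mat" where
  "M\<^sub>2\<^sub>2 m s f \<xi> = moment_mat s s (f\<^sub>2 m s f) (f\<^sub>2 m s f) \<xi>"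

definition schur_solution :: "nat \<Rightarrow> nat \<Rightarrow> (nat \<Rightarrow> 'a \<Rightarrow> real) \<Rightarrow> 'a pmf \<Rightarrow> real mat \<Rightarrow> bool" where
  "schur_solution m s f \<xi> X \<longleftrightarrow>
     X \<in> carrier_mat (m - s + 1) s \<and> M\<^sub>1\<^sub>1 m s f \<xi> * X = M\<^sub>1\<^sub>2 m s f \<xi>"

text \<open>
  The Schur complement does not depend on the chosen solution, see \<open>schur_complement_eq\<close> below.
  It is only meaningful for \<open>\<xi>\<close> admitting a solution.
\<close>

definition schur_complement :: "nat \<Rightarrow> nat \<Rightarrow> (nat \<Rightarrow> 'a \<Rightarrow> real) \<Rightarrow> 'a pmf \<Rightarrow> real mat" where
  "schur_complement m s f \<xi> =
     (let X = (SOME X. schur_solution m s f \<xi> X)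
      in M\<^sub>2\<^sub>2 m s f \<xi> - X\<^sup>T * M\<^sub>1\<^sub>1 m s f \<xi> * X)"

lemma schur_complement_eq:
  assumes X: "schur_solution m s f \<xi> X"
  shows "schur_complement m s f \<xi> = M\<^sub>2\<^sub>2 m s f \<xi> - X\<^sup>T * M\<^sub>1\<^sub>1 m s f \<xi> * X"
proof -
  let ?M = "M\<^sub>1\<^sub>1 m s f \<xi>" and ?n = "m - s + 1"
  define Y where "Y = (SOME X. schur_solution m s f \<xi> X)"
  have Y: "schur_solution m s f \<xi> Y"
    unfolding Y_def using X by (rule someI)
  have M: "?M \<in> carrier_mat ?n ?n" "?M\<^sup>T = ?M"
    by (auto simp: M\<^sub>1\<^sub>1_def moment_mat_def mult.commute intro!: eq_matI)
  from X Y have c: "X \<in> carrier_mat ?n s" "Y \<in> carrier_mat ?n s" "?M * X = ?M * Y"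
    by (auto simp: schur_solution_def)
  have t: "Z\<^sup>T * ?M = (?M * Z)\<^sup>T" if "Z \<in> carrier_mat ?n s" for Z
    using transpose_mult[OF M(1) that] M(2) by simp
  have "Y\<^sup>T * ?M * Y = X\<^sup>T * ?M * Y"
    using t c by simp
  also have "\<dots> = X\<^sup>T * (?M * Y)"
    by (rule assoc_mult_mat[where ?n\<^sub>1 = s and ?n\<^sub>2 = ?n and ?n\<^sub>3 = ?n and ?n\<^sub>4 = s]) (use c M in auto)
  also have "\<dots> = X\<^sup>T * ?M * X"
    unfolding c(3)[symmetric]
    by (rule assoc_mult_mat[where ?n\<^sub>1 = s and ?n\<^sub>2 = ?n and ?n\<^sub>3 = ?n and ?n\<^sub>4 = s, symmetric])
      (use c M in auto)
  finally show ?thesis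
    by (simp add: schur_complement_def Y_def[symmetric])
qed

definition prior_block :: "nat \<Rightarrow> (nat \<Rightarrow> real) \<Rightarrow> real mat" where
  "prior_block s b =
     four_block_mat
       (mat (s - 1) (s - 1) (\<lambda>(i, j). b (i + 1) * b (j + 1))) (mat (s - 1) 1 (\<lambda>(i, j). b (i + 1)))
       (mat 1 (s - 1) (\<lambda>(i, j). b (j + 1)))                   (mat 1 1 (\<lambda>(i, j). 1))"

definition L_exists :: "nat \<Rightarrow> (nat \<Rightarrow> real) measure \<Rightarrow> bool" where
  "L_exists s \<pi> \<longleftrightarrow> (\<forall>i<s. \<forall>j<s. integrable \<pi> (\<lambda>b. prior_block s b $$ (i, j)))"

definition L_mat :: "nat \<Rightarrow> (nat \<Rightarrow> real) measure \<Rightarrow> real mat" where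
  "L_mat s \<pi> = mat s s (\<lambda>(i, j). \<integral>b. prior_block s b $$ (i, j) \<partial>\<pi>)"

definition tr :: "real mat \<Rightarrow> real" where
  "tr A = sum_list (diag_mat A)"

definition in_schur_class :: "'a set \<Rightarrow> nat \<Rightarrow> nat \<Rightarrow> (nat \<Rightarrow> 'a \<Rightarrow> real) \<Rightarrow> 'a pmf \<Rightarrow> bool" where
  "in_schur_class \<X> m s f \<xi> \<longleftrightarrow> approximate_design \<X> \<xi> \<and> (\<exists>X. schur_solution m s f \<xi> X)"

definition maximizes_linear_criterion ::
  "'a set \<Rightarrow> nat \<Rightarrow> nat \<Rightarrow> (nat \<Rightarrow> 'a \<Rightarrow> real) \<Rightarrow> real mat \<Rightarrow> 'a pmf \<Rightarrow> bool" where
  "maximizes_linear_criterion \<X> m s f L \<xi> \<longleftrightarrow>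
     in_schur_class \<X> m s f \<xi> \<and>
     (\<forall>\<zeta>. in_schur_class \<X> m s f \<zeta> \<longrightarrow>
        tr (L * schur_complement m s f \<zeta>) \<le> tr (L * schur_complement m s f \<xi>))"

end

theory Submission
  imports Defs
begin

text \<open>
  Fix a design \<open>\<xi>\<close> and write \<open>\<beta> = (b, 1)\<close>. The infimum inside \<open>V_B\<close> is a least squares problem: the
  function \<open>\<beta>\<^sup>T f\<^sub>2\<close> is approximated by linear combinations of the entries of \<open>f\<^sub>1\<close> in the mean square
  sense of \<open>\<xi>\<close>. Its normal equations, solved for all entries of \<open>f\<^sub>2\<close> at once, are
  \<open>M\<^sub>1\<^sub>1 X = M\<^sub>1\<^sub>2\<close>. Orthogonal projections onto the span of finitely many functions exist even if these
  functions are linearly dependent on the support of \<open>\<xi>\<close>, so the normal equations are solvable for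
  every approximate design (\<open>ex_schur_solution\<close>), and both optimality notions
  range over the same designs.

  If \<open>X\<close> is a solution, then \<open>X \<beta>\<close> attains the infimum for each \<open>b\<close>. The columns of \<open>X\<close> give the
  residuals \<open>f\<^sub>2 - X\<^sup>T f\<^sub>1\<close>, whose Gram matrix is the Schur complement \<open>S\<close>
  (\<open>schur_complement_index\<close>), so the infimum is the quadratic form \<open>\<beta>\<^sup>T S \<beta>\<close>
  (\<open>INF_eta_bar_eq\<close>). It depends on the prior only through \<open>\<beta> \<beta>\<^sup>T\<close>, and integration gives
  \<open>V_B \<xi> = tr (L S)\<close> (\<open>V_B_eq_tr\<close>). The two criteria are therefore the same function.
\<close>

section \<open>Least squares for finitely supported distributions\<close>

lemma integrable_finite_support:
  fixes g :: "'a \<Rightarrow> real"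
  shows "finite (set_pmf p) \<Longrightarrow> integrable (measure_pmf p) g"
  by (rule integrable_measure_pmf_finite)

lemma expectation_diff_sum:
  fixes u :: "'a \<Rightarrow> real"
  assumes "finite (set_pmf p)"
  shows "measure_pmf.expectation p (\<lambda>x. u x - (\<Sum>j\<in>J. a j * h j x))
    = measure_pmf.expectation p u - (\<Sum>j\<in>J. a j * measure_pmf.expectation p (h j))"
  by (subst Bochner_Integration.integral_diff)
    (simp_all add: integrable_finite_support[OF assms])

text \<open>
  Gram-Schmidt, one function at a time. The residual \<open>h\<close> of the new function after projection onto
  the earlier ones may vanish almost surely; then nothing has to be subtracted, which is
  what division by zero yields.
\<close>

lemma ex_orthogonal_residual:
  fixes f :: "nat \<Rightarrow> 'a \<Rightarrow> real"
  assumes fin: "finite (set_pmf p)"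
  shows "\<exists>c. \<forall>i<n. measure_pmf.expectation p (\<lambda>x. f i x * (g x - (\<Sum>j<n. c j * f j x))) = 0"
proof (induction n arbitrary: g)
  case 0
  show ?case by simp
next
  case (Suc n)
  let ?E = "measure_pmf.expectation p"
  note int [simp] = integrable_finite_support[OF fin]
  obtain c where c: "\<And>i. i < n \<Longrightarrow> ?E (\<lambda>x. f i x * (g x - (\<Sum>j<n. c j * f j x))) = 0"
    using Suc.IH[of g] by blast
  obtain d where d: "\<And>i. i < n \<Longrightarrow> ?E (\<lambda>x. f i x * (f n x - (\<Sum>j<n. d j * f j x))) = 0"
    using Suc.IH[of "f n"] by blast
  define r where "r x = g x - (\<Sum>j<n. c j * f j x)" for x
  define h where "h x = f n x - (\<Sum>j<n. d j * f j x)" for x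
  define t where "t = ?E (\<lambda>x. h x * r x) / ?E (\<lambda>x. h x * h x)"
  define e where "e j = (if j = n then t else c j - t * d j)" for j
  have res: "g x - (\<Sum>j<Suc n. e j * f j x) = r x - t * h x" for x
  proof -
    have "(\<Sum>j<n. e j * f j x) = (\<Sum>j<n. c j * f j x) - t * (\<Sum>j<n. d j * f j x)"
      by (simp add: e_def sum_subtractf[symmetric] sum_distrib_left algebra_simps)
    then show ?thesis by (simp add: r_def h_def e_def algebra_simps)
  qed
  have orth: "?E (\<lambda>x. f i x * (r x - t * h x)) = 0" if "i < n" for i
  proof -
    have "?E (\<lambda>x. f i x * (r x - t * h x)) = ?E (\<lambda>x. f i x * r x - t * (f i x * h x))"
      by (simp add: algebra_simps)
    also have "\<dots> = 0" using c[OF that] d[OF that] by (simp add: r_def h_def)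
    finally show ?thesis .
  qed
  have orth_h: "?E (\<lambda>x. h x * (r x - t * h x)) = 0"
  proof -
    have "?E (\<lambda>x. h x * (r x - t * h x)) = ?E (\<lambda>x. h x * r x - t * (h x * h x))"
      by (simp add: algebra_simps)
    also have "\<dots> = ?E (\<lambda>x. h x * r x) - t * ?E (\<lambda>x. h x * h x)" by simp
    also have "\<dots> = 0"
    proof (cases "?E (\<lambda>x. h x * h x) = 0")
      case True
      then have "AE x in measure_pmf p. h x * h x = 0"
        by (subst (asm) integral_nonneg_eq_0_iff_AE) auto
      then have "?E (\<lambda>x. h x * r x) = ?E (\<lambda>x. 0)"
        by (intro integral_cong_AE) (auto simp: AE_measure_pmf_iff)
      with True show ?thesis by simp
    qed (simp add: t_def)
    finally show ?thesis .
  qed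
  \<comment> \<open>The new function is \<open>h\<close> plus a combination of the earlier ones.\<close>
  have "?E (\<lambda>x. f n x * (r x - t * h x))
      = ?E (\<lambda>x. h x * (r x - t * h x) + (\<Sum>j<n. d j * (f j x * (r x - t * h x))))"
  proof (intro arg_cong[where f = ?E] ext)
    fix x
    have "(\<Sum>j<n. d j * (f j x * (r x - t * h x))) = (\<Sum>j<n. d j * f j x) * (r x - t * h x)"
      by (simp add: sum_distrib_right mult.assoc)
    then show "f n x * (r x - t * h x)
        = h x * (r x - t * h x) + (\<Sum>j<n. d j * (f j x * (r x - t * h x)))"
      by (simp add: h_def algebra_simps)
  qed
  also have "\<dots> = ?E (\<lambda>x. h x * (r x - t * h x))
      + (\<Sum>j<n. d j * ?E (\<lambda>x. f j x * (r x - t * h x)))"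
    by (subst Bochner_Integration.integral_add) simp_all
  also have "\<dots> = 0" using orth orth_h by simp
  finally have "\<forall>i<Suc n. ?E (\<lambda>x. f i x * (r x - t * h x)) = 0"
    using orth by (auto simp: less_Suc_eq)
  then show ?case unfolding res[symmetric] by blast
qed

text \<open>
  Pythagoras: moving the coefficients away from a solution of the normal equations adds the squared
  distance between the two approximants to the error.
\<close>

lemma INF_least_squares:
  fixes f :: "nat \<Rightarrow> 'a \<Rightarrow> real"
  assumes fin: "finite (set_pmf p)" and q: "q \<in> carrier_vec n"
    and orth: "\<And>i. i < n \<Longrightarrow>
      measure_pmf.expectation p (\<lambda>x. f i x * ((\<Sum>j<n. q $ j * f j x) - r x)) = 0"
  shows "(INF q\<in>carrier_vec n. measure_pmf.expectation p (\<lambda>x. ((\<Sum>j<n. q $ j * f j x) - r x)\<^sup>2))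
    = measure_pmf.expectation p (\<lambda>x. ((\<Sum>j<n. q $ j * f j x) - r x)\<^sup>2)"
proof (rule cInf_eq_minimum)
  let ?E = "measure_pmf.expectation p"
  show "?E (\<lambda>x. ((\<Sum>j<n. q $ j * f j x) - r x)\<^sup>2)
      \<in> (\<lambda>q. ?E (\<lambda>x. ((\<Sum>j<n. q $ j * f j x) - r x)\<^sup>2)) ` carrier_vec n"
    using q by blast
  fix y assume "y \<in> (\<lambda>q. ?E (\<lambda>x. ((\<Sum>j<n. q $ j * f j x) - r x)\<^sup>2)) ` carrier_vec n"
  then obtain u where y: "y = ?E (\<lambda>x. ((\<Sum>j<n. u $ j * f j x) - r x)\<^sup>2)" by blast
  note int [simp] = integrable_finite_support[OF fin]
  define \<rho> where "\<rho> x = (\<Sum>j<n. q $ j * f j x) - r x" for x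
  define \<delta> where "\<delta> x = (\<Sum>j<n. (u $ j - q $ j) * f j x)" for x
  have split: "(\<Sum>j<n. u $ j * f j x) - r x = \<delta> x + \<rho> x" for x
    by (simp add: \<delta>_def \<rho>_def left_diff_distrib sum_subtractf)
  have cross: "?E (\<lambda>x. \<delta> x * \<rho> x) = 0"
  proof -
    have "?E (\<lambda>x. \<delta> x * \<rho> x) = ?E (\<lambda>x. \<Sum>j<n. (u $ j - q $ j) * (f j x * \<rho> x))"
      by (simp add: \<delta>_def sum_distrib_right mult.assoc)
    also have "\<dots> = (\<Sum>j<n. (u $ j - q $ j) * ?E (\<lambda>x. f j x * \<rho> x))" by simp
    also have "\<dots> = 0" using orth by (simp add: \<rho>_def)
    finally show ?thesis .
  qed
  have "y = ?E (\<lambda>x. (\<delta> x)\<^sup>2 + 2 * (\<delta> x * \<rho> x) + (\<rho> x)\<^sup>2)"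
    by (simp add: y split power2_sum algebra_simps)
  also have "\<dots> = ?E (\<lambda>x. (\<delta> x)\<^sup>2) + ?E (\<lambda>x. (\<rho> x)\<^sup>2)" by (simp add: cross)
  finally show "?E (\<lambda>x. ((\<Sum>j<n. q $ j * f j x) - r x)\<^sup>2) \<le> y"
    by (simp add: \<rho>_def)
qed

section \<open>Normal equations and the Schur complement\<close>

definition residual ::
  "nat \<Rightarrow> nat \<Rightarrow> (nat \<Rightarrow> 'a \<Rightarrow> real) \<Rightarrow> real mat \<Rightarrow> nat \<Rightarrow> 'a \<Rightarrow> real" where
  "residual m s f X k x = f (m - s + 1 + k) x - (\<Sum>i<m - s + 1. X $$ (i, k) * f i x)"

text \<open>Read entrywise, \<open>M\<^sub>1\<^sub>1 X = M\<^sub>1\<^sub>2\<close> says that the residuals are orthogonal to the smaller model.\<close>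

lemma schur_solution_iff_orthogonal:
  assumes fin: "finite (set_pmf \<xi>)" and X: "X \<in> carrier_mat (m - s + 1) s"
  shows "schur_solution m s f \<xi> X \<longleftrightarrow>
    (\<forall>i<m - s + 1. \<forall>k<s. measure_pmf.expectation \<xi> (\<lambda>x. f i x * residual m s f X k x) = 0)"
proof -
  let ?E = "measure_pmf.expectation \<xi>" and ?n = "m - s + 1"
  have "?E (\<lambda>x. f i x * residual m s f X k x)
      = M\<^sub>1\<^sub>2 m s f \<xi> $$ (i, k) - (M\<^sub>1\<^sub>1 m s f \<xi> * X) $$ (i, k)" if ik: "i < ?n" "k < s" for i k
  proof -
    have "?E (\<lambda>x. f i x * residual m s f X k x)
        = ?E (\<lambda>x. f i x * f (?n + k) x - (\<Sum>j<?n. X $$ (j, k) * (f i x * f j x)))"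
      by (simp add: residual_def right_diff_distrib sum_distrib_left mult_ac del: sum.lessThan_Suc)
    also have "\<dots> = ?E (\<lambda>x. f i x * f (?n + k) x) - (\<Sum>j<?n. X $$ (j, k) * ?E (\<lambda>x. f i x * f j x))"
      by (rule expectation_diff_sum[OF fin])
    also have "\<dots> = ?E (\<lambda>x. f i x * f (?n + k) x) - (\<Sum>j<?n. ?E (\<lambda>x. f i x * f j x) * X $$ (j, k))"
      by (simp only: mult.commute)
    finally show ?thesis
      using ik X by (simp add: M\<^sub>1\<^sub>1_def M\<^sub>1\<^sub>2_def moment_mat_def f\<^sub>1_def f\<^sub>2_def scalar_prod_def
          atLeast0LessThan del: sum.lessThan_Suc)
  qed
  then show ?thesis
    using X by (auto simp: schur_solution_def mat_eq_iff M\<^sub>1\<^sub>1_def M\<^sub>1\<^sub>2_def moment_mat_def)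
qed

lemma ex_schur_solution:
  assumes fin: "finite (set_pmf \<xi>)"
  shows "\<exists>X. schur_solution m s f \<xi> X"
proof -
  let ?E = "measure_pmf.expectation \<xi>" and ?n = "m - s + 1"
  have "\<exists>c. \<forall>k. \<forall>i<?n. ?E (\<lambda>x. f i x * (f (?n + k) x - (\<Sum>j<?n. c k j * f j x))) = 0"
    by (intro choice allI ex_orthogonal_residual[OF fin])
  then obtain c where c:
    "\<And>k i. i < ?n \<Longrightarrow> ?E (\<lambda>x. f i x * (f (?n + k) x - (\<Sum>j<?n. c k j * f j x))) = 0"
    by blast
  define X where "X = mat ?n s (\<lambda>(i, k). c k i)"
  have "X \<in> carrier_mat ?n s" by (simp add: X_def)
  moreover have "residual m s f X k = (\<lambda>x. f (?n + k) x - (\<Sum>j<?n. c k j * f j x))" if "k < s" for k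
    using that by (auto simp: residual_def X_def fun_eq_iff)
  ultimately have "schur_solution m s f \<xi> X"
    using c by (subst schur_solution_iff_orthogonal[OF fin]) auto
  then show ?thesis ..
qed

text \<open>
  A residual is orthogonal to the smaller model, so in its product with another residual
  only \<open>f\<^sub>2\<close> contributes; this gives \<open>M\<^sub>2\<^sub>2 - X\<^sup>T M\<^sub>1\<^sub>2\<close>, and \<open>M\<^sub>1\<^sub>2 = M\<^sub>1\<^sub>1 X\<close>.
\<close>

lemma schur_complement_index:
  assumes fin: "finite (set_pmf \<xi>)" and X: "schur_solution m s f \<xi> X" and jk: "j < s" "k < s"
  shows "schur_complement m s f \<xi> $$ (j, k)
    = measure_pmf.expectation \<xi> (\<lambda>x. residual m s f X j x * residual m s f X k x)"
proof -
  let ?E = "measure_pmf.expectation \<xi>" and ?n = "m - s + 1"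
  have Xc: "X \<in> carrier_mat ?n s" and eq: "M\<^sub>1\<^sub>1 m s f \<xi> * X = M\<^sub>1\<^sub>2 m s f \<xi>"
    using X by (auto simp: schur_solution_def)
  have "M\<^sub>1\<^sub>1 m s f \<xi> \<in> carrier_mat ?n ?n" by (simp add: M\<^sub>1\<^sub>1_def moment_mat_def)
  then have "X\<^sup>T * M\<^sub>1\<^sub>1 m s f \<xi> * X = X\<^sup>T * M\<^sub>1\<^sub>2 m s f \<xi>"
    using Xc unfolding eq[symmetric] by (intro assoc_mult_mat) auto
  then have "schur_complement m s f \<xi> $$ (j, k) = (M\<^sub>2\<^sub>2 m s f \<xi> - X\<^sup>T * M\<^sub>1\<^sub>2 m s f \<xi>) $$ (j, k)"
    by (simp add: schur_complement_eq[OF X])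
  also have "\<dots> = ?E (\<lambda>x. f (?n + j) x * f (?n + k) x)
      - (\<Sum>i<?n. X $$ (i, j) * ?E (\<lambda>x. f i x * f (?n + k) x))"
    using jk Xc by (simp add: M\<^sub>2\<^sub>2_def M\<^sub>1\<^sub>2_def moment_mat_def f\<^sub>1_def f\<^sub>2_def scalar_prod_def
        atLeast0LessThan del: sum.lessThan_Suc)
  also have "\<dots> = ?E (\<lambda>x. residual m s f X j x * f (?n + k) x)"
  proof -
    have "?E (\<lambda>x. residual m s f X j x * f (?n + k) x)
        = ?E (\<lambda>x. f (?n + j) x * f (?n + k) x - (\<Sum>i<?n. X $$ (i, j) * (f i x * f (?n + k) x)))"
      by (simp add: residual_def left_diff_distrib sum_distrib_right mult.assoc
          del: sum.lessThan_Suc)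
    also have "\<dots> = ?E (\<lambda>x. f (?n + j) x * f (?n + k) x)
      - (\<Sum>i<?n. X $$ (i, j) * ?E (\<lambda>x. f i x * f (?n + k) x))"
      by (rule expectation_diff_sum[OF fin])
    finally show ?thesis by simp
  qed
  also have "\<dots> = ?E (\<lambda>x. residual m s f X j x * residual m s f X k x)"
  proof -
    have orth: "?E (\<lambda>x. f i x * residual m s f X j x) = 0" if "i < ?n" for i
      using X that jk by (subst (asm) schur_solution_iff_orthogonal[OF fin Xc]) auto
    have "?E (\<lambda>x. residual m s f X j x * residual m s f X k x)
        = ?E (\<lambda>x. residual m s f X j x * f (?n + k) x
            - (\<Sum>i<?n. X $$ (i, k) * (f i x * residual m s f X j x)))"
      by (simp add: residual_def[of m s f X k] right_diff_distrib sum_distrib_left mult_ac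
          del: sum.lessThan_Suc)
    also have "\<dots> = ?E (\<lambda>x. residual m s f X j x * f (?n + k) x)
            - (\<Sum>i<?n. X $$ (i, k) * ?E (\<lambda>x. f i x * residual m s f X j x))"
      by (rule expectation_diff_sum[OF fin])
    finally show ?thesis using orth by simp
  qed
  finally show ?thesis .
qed

section \<open>The Bayesian criterion as a linear criterion\<close>

definition ratio_ext :: "nat \<Rightarrow> (nat \<Rightarrow> real) \<Rightarrow> nat \<Rightarrow> real" where
  "ratio_ext s b i = (if i < s - 1 then b (i + 1) else 1)"

lemma prior_block_index:
  "i < s \<Longrightarrow> j < s \<Longrightarrow> prior_block s b $$ (i, j) = ratio_ext s b i * ratio_ext s b j"
  by (auto simp: prior_block_def ratio_ext_def)

lemma eta_bar_eq:
  assumes "1 \<le> s" "s \<le> m"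
  shows "\<eta>_bar m s f x q b
    = (\<Sum>i<m - s + 1. q $ i * f i x) - (\<Sum>k<s. ratio_ext s b k * f (m - s + 1 + k) x)"
proof -
  obtain r where r: "s = Suc r" using assms by (cases s) auto
  have "(\<Sum>i=1..<s. b i * f (m - s + i) x) = (\<Sum>k<r. b (k + 1) * f (m - s + 1 + k) x)"
    by (rule sum.reindex_bij_witness[of _ Suc "\<lambda>i. i - 1"]) (auto simp: r)
  also have "\<dots> = (\<Sum>k<r. ratio_ext s b k * f (m - s + 1 + k) x)"
    by (rule sum.cong) (auto simp: ratio_ext_def r)
  moreover have "ratio_ext s b r * f (m - s + 1 + r) x = f m x"
  proof -
    have "m - s + 1 + r = m" using assms r by simp
    moreover have "ratio_ext s b r = 1" by (simp add: ratio_ext_def r)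
    ultimately show ?thesis by (simp only: mult_1_left)
  qed
  ultimately have "(\<Sum>i=1..<s. b i * f (m - s + i) x) + f m x
      = (\<Sum>k<s. ratio_ext s b k * f (m - s + 1 + k) x)"
    by (simp only: r sum.lessThan_Suc)
  moreover have "{0..m - s} = {..<m - s + 1}" by auto
  ultimately show ?thesis by (simp only: \<eta>_bar_def)
qed

text \<open>
  The minimizer is \<open>X \<beta>\<close> for \<open>\<beta> = (b, 1)\<close>: its error function is the combination of the residuals
  with coefficients \<open>\<beta>\<close>, hence orthogonal to the smaller model.
\<close>

lemma INF_eta_bar_eq:
  assumes fin: "finite (set_pmf \<xi>)" and s: "1 \<le> s" "s \<le> m"
  shows "(INF q \<in> carrier_vec (m - s + 1). measure_pmf.expectation \<xi> (\<lambda>x. (\<eta>_bar m s f x q b)\<^sup>2))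
    = (\<Sum>j<s. \<Sum>k<s. prior_block s b $$ (j, k) * schur_complement m s f \<xi> $$ (j, k))"
proof -
  let ?E = "measure_pmf.expectation \<xi>" and ?n = "m - s + 1" and ?\<beta> = "ratio_ext s b"
  note int [simp] = integrable_finite_support[OF fin]
  obtain X where X: "schur_solution m s f \<xi> X" using ex_schur_solution[OF fin] by blast
  then have Xc: "X \<in> carrier_mat ?n s" by (simp add: schur_solution_def)
  have orth: "?E (\<lambda>x. f i x * residual m s f X k x) = 0" if "i < ?n" "k < s" for i k
    using X that by (subst (asm) schur_solution_iff_orthogonal[OF fin Xc]) auto
  define q where "q = vec ?n (\<lambda>i. \<Sum>k<s. ?\<beta> k * X $$ (i, k))"
  have err: "(\<Sum>i<?n. q $ i * f i x) - (\<Sum>k<s. ?\<beta> k * f (?n + k) x)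
      = - (\<Sum>k<s. ?\<beta> k * residual m s f X k x)" for x
  proof -
    have "(\<Sum>i<?n. q $ i * f i x) = (\<Sum>i<?n. \<Sum>k<s. ?\<beta> k * (X $$ (i, k) * f i x))"
      by (simp add: q_def sum_distrib_right mult.assoc del: sum.lessThan_Suc)
    also have "\<dots> = (\<Sum>k<s. ?\<beta> k * (\<Sum>i<?n. X $$ (i, k) * f i x))"
      by (subst sum.swap) (simp add: sum_distrib_left del: sum.lessThan_Suc)
    finally show ?thesis
      by (simp add: residual_def right_diff_distrib sum_subtractf del: sum.lessThan_Suc)
  qed
  have "(INF q \<in> carrier_vec ?n. ?E (\<lambda>x. (\<eta>_bar m s f x q b)\<^sup>2))
      = ?E (\<lambda>x. ((\<Sum>i<?n. q $ i * f i x) - (\<Sum>k<s. ?\<beta> k * f (?n + k) x))\<^sup>2)"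
    unfolding eta_bar_eq[OF s]
  proof (rule INF_least_squares[OF fin])
    show "q \<in> carrier_vec ?n" by (simp add: q_def)
    fix i assume "i < ?n"
    have "?E (\<lambda>x. f i x * ((\<Sum>j<?n. q $ j * f j x) - (\<Sum>k<s. ?\<beta> k * f (?n + k) x)))
        = ?E (\<lambda>x. - (\<Sum>k<s. ?\<beta> k * (f i x * residual m s f X k x)))"
      unfolding err by (simp add: sum_distrib_left mult_ac)
    also have "\<dots> = - (\<Sum>k<s. ?\<beta> k * ?E (\<lambda>x. f i x * residual m s f X k x))" by simp
    also have "\<dots> = 0" using orth[OF \<open>i < ?n\<close>] by simp
    finally show "?E (\<lambda>x. f i x * ((\<Sum>j<?n. q $ j * f j x) - (\<Sum>k<s. ?\<beta> k * f (?n + k) x))) = 0" .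
  qed
  also have "\<dots> = ?E (\<lambda>x. \<Sum>j<s. \<Sum>k<s. ?\<beta> j * ?\<beta> k * (residual m s f X j x * residual m s f X k x))"
    unfolding err by (simp add: power2_eq_square sum_product mult_ac)
  also have "\<dots> = (\<Sum>j<s. \<Sum>k<s. ?\<beta> j * ?\<beta> k * ?E (\<lambda>x. residual m s f X j x * residual m s f X k x))"
    by simp
  also have "\<dots> = (\<Sum>j<s. \<Sum>k<s. prior_block s b $$ (j, k) * schur_complement m s f \<xi> $$ (j, k))"
    by (simp add: prior_block_index schur_complement_index[OF fin X])
  finally show ?thesis .
qed

lemma V_B_eq_tr:
  assumes fin: "finite (set_pmf \<xi>)" and s: "1 \<le> s" "s \<le> m" and L: "L_exists s \<pi>"
  shows "V_B m s f \<pi> \<xi> = tr (L_mat s \<pi> * schur_complement m s f \<xi>)"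
proof -
  let ?S = "schur_complement m s f \<xi>"
  obtain X where "schur_solution m s f \<xi> X" using ex_schur_solution[OF fin] by blast
  then have Sc: "?S \<in> carrier_mat s s"
    by (auto simp: schur_complement_eq schur_solution_def)
  have int: "integrable \<pi> (\<lambda>b. prior_block s b $$ (j, k))" if "j < s" "k < s" for j k
    using L that by (simp add: L_exists_def)
  have int': "integrable \<pi> (\<lambda>b. prior_block s b $$ (j, k) * ?S $$ (j, k))"
    if "j < s" "k < s" for j k
    using int[OF that] by simp
  have "V_B m s f \<pi> \<xi>
      = (\<integral>b. (\<Sum>j<s. \<Sum>k<s. prior_block s b $$ (j, k) * ?S $$ (j, k)) \<partial>\<pi>)"
    unfolding V_B_def INF_eta_bar_eq[OF fin s] ..
  also have "\<dots> = (\<Sum>j<s. \<integral>b. (\<Sum>k<s. prior_block s b $$ (j, k) * ?S $$ (j, k)) \<partial>\<pi>)"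
    by (intro Bochner_Integration.integral_sum Bochner_Integration.integrable_sum int') auto
  also have "\<dots> = (\<Sum>j<s. \<Sum>k<s. \<integral>b. prior_block s b $$ (j, k) * ?S $$ (j, k) \<partial>\<pi>)"
    by (intro sum.cong refl Bochner_Integration.integral_sum int') auto
  also have "\<dots> = (\<Sum>j<s. \<Sum>k<s. L_mat s \<pi> $$ (j, k) * ?S $$ (j, k))"
    by (simp add: L_mat_def)
  \<comment> \<open>The trace pairs entry \<open>(k, j)\<close> of \<open>L\<close> with entry \<open>(j, k)\<close> of \<open>S\<close>; \<open>L\<close> is symmetric.\<close>
  also have "\<dots> = (\<Sum>j<s. \<Sum>k<s. L_mat s \<pi> $$ (k, j) * ?S $$ (j, k))"
    by (simp add: L_mat_def prior_block_index mult.commute)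
  also have "\<dots> = (\<Sum>k<s. \<Sum>j<s. L_mat s \<pi> $$ (k, j) * ?S $$ (j, k))"
    by (rule sum.swap)
  also have "\<dots> = tr (L_mat s \<pi> * ?S)"
    using Sc by (simp add: tr_def diag_mat_def L_mat_def scalar_prod_def interv_sum_list_conv_sum_set_nat
        atLeast0LessThan)
  finally show ?thesis .
qed

theorem theorem3p1:
  fixes \<X> :: "'a :: euclidean_space set"
    and f :: "nat \<Rightarrow> 'a \<Rightarrow> real"
    and m\<^sub>1 m\<^sub>2 s m :: nat
    and B :: "(nat \<Rightarrow> real) set"
    and \<pi> :: "(nat \<Rightarrow> real) measure"
    and \<xi>star :: "'a pmf"
  assumes "1 \<le> m\<^sub>1" and "m\<^sub>1 < m\<^sub>2"
    and "s = m\<^sub>2 - m\<^sub>1" and "m = m\<^sub>2 - 1"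
    and "compact \<X>"
    and "\<And>i. i \<le> m \<Longrightarrow> continuous_on \<X> (f i)"
    and "linearly_independent_on \<X> m f"
    and "prior_on s B \<pi>"
    and "L_exists s \<pi>"
    and "approximate_design \<X> \<xi>star"
  shows "bayesian_T_optimal \<X> m s f \<pi> \<xi>star \<longleftrightarrow>
         maximizes_linear_criterion \<X> m s f (L_mat s \<pi>) \<xi>star"
proof -
  have s: "1 \<le> s" "s \<le> m" using assms by auto
  have "in_schur_class \<X> m s f \<zeta> \<longleftrightarrow> approximate_design \<X> \<zeta>" for \<zeta>
    using ex_schur_solution by (auto simp: in_schur_class_def approximate_design_def)
  moreover have "V_B m s f \<pi> \<zeta> = tr (L_mat s \<pi> * schur_complement m s f \<zeta>)"
    if "approximate_design \<X> \<zeta>" for \<zeta>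
    using that V_B_eq_tr s \<open>L_exists s \<pi>\<close> by (auto simp: approximate_design_def)
  ultimately show ?thesis
    by (auto simp: bayesian_T_optimal_def maximizes_linear_criterion_def)
qed

end
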